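(* Let $k\in\{0,1\}$ be a sensing decision under which the secondary user transmits with power $P_k>0$ (so $k\in\{0,1\}$ in the SSS scheme, and $k=0$ in the OSA scheme), and let the transmitted symbol be equiprobable on the rectangular $M_I\times M_Q$ QAM constellation $\{s_{n,q}\}$ with minimum distance $d_{min,k}$. Let $h\neq 0$ be the fading coefficient, known at the receiver, and let $\bar y=\bar y_r+j\bar y_i$ be the phase-compensated received signal. Then the optimal (minimum error probability, i.e. maximum a posteriori) detector given $\hat{\mathcal H}_k$ and $h$ has its thresholds located midway between neighbouring received signal points. That is, for every $\bar y$, the point $s_{n,q}$ maximizes $$\Pr\{\mathcal H_0|\hat{\mathcal H}_k\}\,f(\bar y\,|\,s_{n',q'},h,\hat{\mathcal H}_k,\mathcal H_0)+\Pr\{\mathcal H_1|\hat{\mathcal H}_k\}\,f(\bar y\,|\,s_{n',q'},h,\hat{\mathcal H}_k,\mathcal H_1)$$ over all constellation points $s_{n',q'}$ if and only if all of the following hold: - $\bar y_r\le \big(s_n+\tfrac{d_{min,k}}{2}\big)|h|$ if $n\le M_I-2$; - $\bar y_r\ge \big(s_n-\tfrac{d_{min,k}}{2}\big)|h|$ if $n\ge 1$; - $\bar y_i\le \big(s_q+\tfrac{d_{min,k}}{2}\big)|h|$ if $q\le M_Q-2$; - $\bar y_i\ge \big(s_q-\tfrac{d_{min,k}}{2}\big)|h|$ if $q\ge 1$. Hence the structure of the optimal detector (midpoint thresholds between received points) does not depend on the sensing decision.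
   Context: Setting (cognitive radio with imperfect sensing). The true channel state is $\mathcal H_0$ (primary user idle) or $\mathcal H_1$ (primary user active), with given prior probabilities. The sensing decision is $\hat{\mathcal H}_0$ (idle) or $\hat{\mathcal H}_1$ (busy), with $P_{\rm d}=\Pr\{\hat{\mathcal H}_1|\mathcal H_1\}$ and $P_{\rm f}=\Pr\{\hat{\mathcal H}_1|\mathcal H_0\}$. The posteriors $\Pr\{\mathcal H_j|\hat{\mathcal H}_k\}$ are given by Bayes' rule; assume $\Pr\{\hat{\mathcal H}_k\}>0$ for the decision considered. In the sensing-based spectrum sharing (SSS) scheme the secondary user transmits with power $P_k$ under decision $\hat{\mathcal H}_k$, $k=0,1$. In the opportunistic spectrum access (OSA) scheme it transmits only under $\hat{\mathcal H}_0$, with power $P_0$. Constellation. $M_I,M_Q\ge1$ are integers with $M=M_IM_Q\ge 2$, and $s_{n,q}=s_n+js_q$ with $$s_n=(2n+1-M_I)\tfrac{d_{min,k}}{2}\ (0\le n\le M_I-1),\qquad s_q=(2q+1-M_Q)\tfrac{d_{min,k}}{2}\ (0\le q\le M_Q-1),$$ $$d_{min,k}=\sqrt{\tfrac{12P_k}{M_I^2+M_Q^2-2}}.$$ Here $s_n$ always denotes an in-phase (real) level and $s_q$ a quadrature (imaginary) level. Channel. The received signal is $y=hs+n$ under $\mathcal H_0$ and $y=hs+n+w$ under $\mathcal H_1$. The noise $n$ has density $\frac{1}{2\pi\sigma_n^2}e^{-|n|^2/(2\sigma_n^2)}$ on $\mathbb C$ ($\sigma_n^2>0$). The primary interference $w$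 is independent of $n$ and has Gaussian mixture density $\sum_{l=1}^p\frac{\lambda_l}{2\pi\sigma_l^2}e^{-|w|^2/(2\sigma_l^2)}$, with $\sigma_l^2>0$, $\lambda_l\ge0$, $\sum_l\lambda_l=1$. The receiver forms $\bar y=ye^{-j\theta_h}$, where $\theta_h$ is the phase of $h$. Given the transmitted point, $h$, $\hat{\mathcal H}_k$ and $\mathcal H_j$, the density of $\bar y$ is $$f(\bar y|s_{n,q},h,\hat{\mathcal H}_k,\mathcal H_0)=\frac{1}{2\pi\sigma_n^2}e^{-\frac{(\bar y_r-s_n|h|)^2+(\bar y_i-s_q|h|)^2}{2\sigma_n^2}},$$ $$f(\bar y|s_{n,q},h,\hat{\mathcal H}_k,\mathcal H_1)=\sum_{l=1}^p\frac{\lambda_l}{2\pi(\sigma_l^2+\sigma_n^2)}e^{-\frac{(\bar y_r-s_n|h|)^2+(\bar y_i-s_q|h|)^2}{2(\sigma_l^2+\sigma_n^2)}}.$$ *)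

theory Defs
  imports "HOL-Analysis.Analysis"
begin

datatype channel_state = H0 | H1
datatype decision = Idle | Busy
datatype scheme = SSS | OSA

fun transmit_decisions :: "scheme \<Rightarrow> decision set" where
  "transmit_decisions SSS = {Idle, Busy}"
| "transmit_decisions OSA = {Idle}"

text \<open>
  \<open>std_noise\<close> and \<open>std_interf l\<close> are \<open>\<sigma>\<^sub>n\<close> and \<open>\<sigma>\<^sub>l\<close>; the mixture
  components are indexed by \<open>l \<in> {1..num_comp}\<close>.
\<close>
record cr_system =
  prior :: "channel_state \<Rightarrow> real"
  P_d :: real
  P_f :: real
  tx_power :: "decision \<Rightarrow> real"
  M_I :: nat
  M_Q :: nat
  std_noise :: real
  num_comp :: nat
  weight :: "nat \<Rightarrow> real"
  std_interf :: "nat \<Rightarrow> real"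

definition valid_sensing :: "cr_system \<Rightarrow> bool" where
  "valid_sensing S \<longleftrightarrow>
     prior S H0 \<ge> 0 \<and> prior S H1 \<ge> 0 \<and> prior S H0 + prior S H1 = 1 \<and>
     0 \<le> P_d S \<and> P_d S \<le> 1 \<and> 0 \<le> P_f S \<and> P_f S \<le> 1"

definition valid_channel :: "cr_system \<Rightarrow> bool" where
  "valid_channel S \<longleftrightarrow>
     (std_noise S)\<^sup>2 > 0 \<and>
     (\<forall>l\<in>{1..num_comp S}. (std_interf S l)\<^sup>2 > 0 \<and> weight S l \<ge> 0) \<and>
     (\<Sum>l=1..num_comp S. weight S l) = 1"

fun sensing_prob :: "cr_system \<Rightarrow> decision \<Rightarrow> channel_state \<Rightarrow> real" where
  "sensing_prob S Busy H1 = P_d S"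
| "sensing_prob S Idle H1 = 1 - P_d S"
| "sensing_prob S Busy H0 = P_f S"
| "sensing_prob S Idle H0 = 1 - P_f S"

definition decision_prob :: "cr_system \<Rightarrow> decision \<Rightarrow> real" where
  "decision_prob S k = prior S H0 * sensing_prob S k H0 + prior S H1 * sensing_prob S k H1"

definition state_posterior :: "cr_system \<Rightarrow> channel_state \<Rightarrow> decision \<Rightarrow> real" where
  "state_posterior S j k = prior S j * sensing_prob S k j / decision_prob S k"

definition d_min :: "cr_system \<Rightarrow> decision \<Rightarrow> real" where
  "d_min S k = sqrt (12 * tx_power S k / ((real (M_I S))\<^sup>2 + (real (M_Q S))\<^sup>2 - 2))"

definition level_I :: "cr_system \<Rightarrow> decision \<Rightarrow> nat \<Rightarrow> real" where
  "level_I S k n = (2 * real n + 1 - real (M_I S)) * (d_min S k / 2)"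

definition level_Q :: "cr_system \<Rightarrow> decision \<Rightarrow> nat \<Rightarrow> real" where
  "level_Q S k q = (2 * real q + 1 - real (M_Q S)) * (d_min S k / 2)"

definition symbol_indices :: "cr_system \<Rightarrow> (nat \<times> nat) set" where
  "symbol_indices S = {..<M_I S} \<times> {..<M_Q S}"

definition symbol :: "cr_system \<Rightarrow> decision \<Rightarrow> nat \<times> nat \<Rightarrow> complex" where
  "symbol S k i = Complex (level_I S k (fst i)) (level_Q S k (snd i))"

text \<open>
  Density at \<open>y\<close> of the phase-compensated received signal when the point \<open>s\<close> is
  sent. Given \<open>s\<close> and the true channel state it depends on the sensing decision
  only through \<open>s\<close>, whose power is set by the decision.
\<close>
fun received_density ::
  "cr_system \<Rightarrow> complex \<Rightarrow> channel_state \<Rightarrow> complex \<Rightarrow> complex \<Rightarrow> real" where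
  "received_density S h H0 s y =
     1 / (2 * pi * (std_noise S)\<^sup>2) *
     exp (- ((Re y - Re s * cmod h)\<^sup>2 + (Im y - Im s * cmod h)\<^sup>2) / (2 * (std_noise S)\<^sup>2))"
| "received_density S h H1 s y =
     (\<Sum>l=1..num_comp S. weight S l / (2 * pi * ((std_interf S l)\<^sup>2 + (std_noise S)\<^sup>2)) *
       exp (- ((Re y - Re s * cmod h)\<^sup>2 + (Im y - Im s * cmod h)\<^sup>2) /
            (2 * ((std_interf S l)\<^sup>2 + (std_noise S)\<^sup>2))))"

definition likelihood ::
  "cr_system \<Rightarrow> complex \<Rightarrow> decision \<Rightarrow> complex \<Rightarrow> nat \<times> nat \<Rightarrow> real" where
  "likelihood S h k y i =
     state_posterior S H0 k * received_density S h H0 (symbol S k i) y +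
     state_posterior S H1 k * received_density S h H1 (symbol S k i) y"

definition symbol_prior :: "cr_system \<Rightarrow> nat \<times> nat \<Rightarrow> real" where
  "symbol_prior S i = 1 / real (card (symbol_indices S))"

definition symbol_posterior ::
  "cr_system \<Rightarrow> complex \<Rightarrow> decision \<Rightarrow> complex \<Rightarrow> nat \<times> nat \<Rightarrow> real" where
  "symbol_posterior S h k y i =
     symbol_prior S i * likelihood S h k y i /
     (\<Sum>i'\<in>symbol_indices S. symbol_prior S i' * likelihood S h k y i')"

definition detectors :: "cr_system \<Rightarrow> (complex \<Rightarrow> nat \<times> nat) set" where
  "detectors S = measurable borel (count_space (symbol_indices S))"

text \<open>Symbol error probability of a detector, conditional on the decision and on \<open>h\<close>.\<close>
definition error_prob ::
  "cr_system \<Rightarrow> complex \<Rightarrow> decision \<Rightarrow> (complex \<Rightarrow> nat \<times> nat) \<Rightarrow> real" where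
  "error_prob S h k \<delta> =
     (\<Sum>i\<in>symbol_indices S. symbol_prior S i *
        set_lebesgue_integral lborel {y. \<delta> y \<noteq> i} (\<lambda>y. likelihood S h k y i))"

text \<open>
  The guards are written \<open>n + 2 \<le> M_I S\<close> because \<open>n \<le> M_I S - 2\<close> would hold for
  \<open>n = 0\<close> and \<open>M_I S = 1\<close> under truncated subtraction.
\<close>
definition midpoint_region ::
  "cr_system \<Rightarrow> complex \<Rightarrow> decision \<Rightarrow> nat \<times> nat \<Rightarrow> complex set" where
  "midpoint_region S h k = (\<lambda>(n, q). {y.
     (n + 2 \<le> M_I S \<longrightarrow> Re y \<le> (level_I S k n + d_min S k / 2) * cmod h) \<and>
     (1 \<le> n \<longrightarrow> Re y \<ge> (level_I S k n - d_min S k / 2) * cmod h) \<and>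
     (q + 2 \<le> M_Q S \<longrightarrow> Im y \<le> (level_Q S k q + d_min S k / 2) * cmod h) \<and>
     (1 \<le> q \<longrightarrow> Im y \<ge> (level_Q S k q - d_min S k / 2) * cmod h)})"

end

theory Submission
  imports Defs "HOL-Probability.Distributions"
begin

text \<open>
  Whatever the decision, the likelihood of a point is one and the same strictly decreasing
  function (a mixture of centred Gaussians) of its distance to the received signal, so maximising
  it means minimising the distance. On a rectangular grid this splits into two one-dimensional
  nearest-level problems. As the symbols are equiprobable, the probability of a correct decision
  is the integral of the likelihood of the decided point; a detector maximises it precisely when
  it cannot be improved by switching to a fixed symbol \<open>i\<close> wherever \<open>i\<close> is more likely, that is,
  when it picks a most likely point almost everywhere.
\<close>

section \<open>Nearest points of the constellation\<close>

text \<open>Levels are spaced by \<open>2 * e\<close>, so \<open>u n + e\<close> and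
  \<open>u n - e\<close> are midpoints to the neighbours. Comparing squared distances to two levels
  is a linear condition on \<open>x\<close>, and among equally spaced levels the conditions for the
  two neighbours imply all the others.\<close>

lemma nearest_level_iff:
  fixes x e :: real and n N :: nat
  defines "u \<equiv> \<lambda>m::nat. (2 * real m + 1 - real N) * e"
  assumes e: "e > 0" and n: "n < N"
  shows "(\<forall>m<N. (x - u n)\<^sup>2 \<le> (x - u m)\<^sup>2) \<longleftrightarrow>
    (n + 2 \<le> N \<longrightarrow> x \<le> u n + e) \<and> (1 \<le> n \<longrightarrow> x \<ge> u n - e)"
proof -
  \<comment> \<open>Difference of two squares, with
    \<open>u m - u n = 2 * e * (real m - real n)\<close> substituted in both factors.\<close>
  have diff: "(x - u m)\<^sup>2 - (x - u n)\<^sup>2 =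
      4 * e * ((real m - real n) * (u n + e * (real m - real n) - x))" for m
    unfolding u_def by (simp add: power2_eq_square algebra_simps)
  have cmp: "(x - u n)\<^sup>2 \<le> (x - u m)\<^sup>2 \<longleftrightarrow>
      0 \<le> (real m - real n) * (u n + e * (real m - real n) - x)" for m
  proof -
    have "(x - u n)\<^sup>2 \<le> (x - u m)\<^sup>2 \<longleftrightarrow> 0 \<le> (x - u m)\<^sup>2 - (x - u n)\<^sup>2"
      by simp
    then show ?thesis
      unfolding diff using e by (simp add: zero_le_mult_iff)
  qed
  show ?thesis
  proof (intro iffI conjI impI allI)
    assume A: "\<forall>m<N. (x - u n)\<^sup>2 \<le> (x - u m)\<^sup>2" and "n + 2 \<le> N"
    then have "(x - u n)\<^sup>2 \<le> (x - u (n + 1))\<^sup>2" by simp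
    then show "x \<le> u n + e" unfolding cmp by simp
  next
    assume A: "\<forall>m<N. (x - u n)\<^sup>2 \<le> (x - u m)\<^sup>2" and "1 \<le> n"
    then have "(x - u n)\<^sup>2 \<le> (x - u (n - 1))\<^sup>2" using n by simp
    then show "x \<ge> u n - e" unfolding cmp using \<open>1 \<le> n\<close> by (simp add: of_nat_diff)
  next
    fix m
    assume B: "(n + 2 \<le> N \<longrightarrow> x \<le> u n + e) \<and> (1 \<le> n \<longrightarrow> x \<ge> u n - e)" and "m < N"
    consider "m = n" | "n < m" | "m < n" by linarith
    then show "(x - u n)\<^sup>2 \<le> (x - u m)\<^sup>2"
    proof cases
      case 2
      then have "x \<le> u n + e" "1 \<le> real m - real n" using B \<open>m < N\<close> by auto
      \<comment> \<open>The midpoint between levels \<open>n\<close> and \<open>m\<close> lies at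
        least as far out as the midpoint to the adjacent level, because the indices differ by at
        least 1. The case below is the mirror image.\<close>
      then have "x \<le> u n + e * (real m - real n)"
        using mult_left_mono[of 1 "real m - real n" e] e by linarith
      then show ?thesis unfolding cmp using 2 by simp
    next
      case 3
      then have "x \<ge> u n - e" "1 \<le> real n - real m" using B by auto
      then have "x \<ge> u n + e * (real m - real n)"
        using mult_left_mono[of 1 "real n - real m" e] e by (simp add: algebra_simps)
      then show ?thesis unfolding cmp using 3 by (simp add: mult_nonpos_nonpos)
    qed simp
  qed
qed

text \<open>Fixing one index at its value in the minimising pair cancels that summand; the converse
  adds the two inequalities.\<close>

lemma min_on_product_iff:
  fixes f g :: "nat \<Rightarrow> real"
  assumes "n < A" "q < B"
  shows "(\<forall>m<A. \<forall>r<B. f n + g q \<le> f m + g r) \<longleftrightarrow>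
    (\<forall>m<A. f n \<le> f m) \<and> (\<forall>r<B. g q \<le> g r)"
  using assms by (meson add_le_cancel_left add_le_cancel_right add_mono)

text \<open>By the AM-GM inequality the sum of squares is at least \<open>2 * M_I S * M_Q S\<close>,
  hence at least 4, so the denominator under the root is positive.\<close>

lemma d_min_pos:
  assumes "M_I S \<ge> 1" "M_Q S \<ge> 1" "M_I S * M_Q S \<ge> 2" "tx_power S k > 0"
  shows "d_min S k > 0"
proof -
  have "real (M_I S * M_Q S) \<ge> real 2"
    using assms(3) by (rule of_nat_mono)
  moreover have "(real (M_I S))\<^sup>2 + (real (M_Q S))\<^sup>2 \<ge> 2 * (real (M_I S) * real (M_Q S))"
    using sum_squares_bound[of "real (M_I S)" "real (M_Q S)"] by (simp add: mult.assoc)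
  ultimately have "(real (M_I S))\<^sup>2 + (real (M_Q S))\<^sup>2 - 2 > 0"
    by simp
  then show ?thesis
    unfolding d_min_def using assms(4) by simp
qed

definition received_dist2 ::
  "cr_system \<Rightarrow> complex \<Rightarrow> decision \<Rightarrow> complex \<Rightarrow> nat \<times> nat \<Rightarrow> real" where
  "received_dist2 S h k y i =
     (Re y - level_I S k (fst i) * cmod h)\<^sup>2 + (Im y - level_Q S k (snd i) * cmod h)\<^sup>2"

lemma nearest_point_iff_midpoint:
  assumes "d_min S k > 0" "h \<noteq> 0" and i: "i \<in> symbol_indices S"
  shows "(\<forall>j\<in>symbol_indices S. received_dist2 S h k y i \<le> received_dist2 S h k y j) \<longleftrightarrow>
    y \<in> midpoint_region S h k i"
proof -
  obtain n q where iq: "i = (n, q)" by (cases i)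
  have n: "n < M_I S" and q: "q < M_Q S"
    using i by (auto simp: iq symbol_indices_def)
  \<comment> \<open>Half the spacing of the received levels: the channel scales the constellation by
    \<open>cmod h\<close>.\<close>
  define e where "e = d_min S k / 2 * cmod h"
  have e: "e > 0" using assms by (simp add: e_def)
  have "(\<forall>j\<in>symbol_indices S. received_dist2 S h k y i \<le> received_dist2 S h k y j) \<longleftrightarrow>
      (\<forall>m<M_I S. \<forall>r<M_Q S.
        (Re y - level_I S k n * cmod h)\<^sup>2 + (Im y - level_Q S k q * cmod h)\<^sup>2 \<le>
        (Re y - level_I S k m * cmod h)\<^sup>2 + (Im y - level_Q S k r * cmod h)\<^sup>2)"
    by (auto simp: symbol_indices_def received_dist2_def iq)
  also have "\<dots> \<longleftrightarrow>
      (\<forall>m<M_I S. (Re y - level_I S k n * cmod h)\<^sup>2 \<le> (Re y - level_I S k m * cmod h)\<^sup>2) \<and>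
      (\<forall>r<M_Q S. (Im y - level_Q S k q * cmod h)\<^sup>2 \<le> (Im y - level_Q S k r * cmod h)\<^sup>2)"
    by (rule min_on_product_iff[OF n q])
  also have "\<dots> \<longleftrightarrow> y \<in> midpoint_region S h k i"
    using nearest_level_iff[OF e n, of "Re y"] nearest_level_iff[OF e q, of "Im y"]
    by (simp add: midpoint_region_def iq level_I_def level_Q_def e_def distrib_right
        left_diff_distrib mult.assoc)
  finally show ?thesis .
qed

section \<open>The likelihood as a function of the distance\<close>

lemma state_posterior_nonneg:
  assumes "valid_sensing S" "decision_prob S k > 0"
  shows "state_posterior S j k \<ge> 0"
  using assms by (cases j; cases k) (auto simp: state_posterior_def valid_sensing_def)

lemma state_posterior_sum:
  assumes "decision_prob S k > 0"
  shows "state_posterior S H0 k + state_posterior S H1 k = 1"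
  using assms unfolding state_posterior_def
  by (simp add: decision_prob_def flip: add_divide_distrib)

text \<open>Density of a centred circular complex Gaussian with variance \<open>v\<close> per real
  component, written as a function of the squared modulus \<open>r\<close>.\<close>

definition gauss_kernel :: "real \<Rightarrow> real \<Rightarrow> real" where
  "gauss_kernel v r = 1 / (2 * pi * v) * exp (- r / (2 * v))"

lemma gauss_kernel_pos: "v > 0 \<Longrightarrow> gauss_kernel v r > 0"
  by (simp add: gauss_kernel_def)

lemma gauss_kernel_strict_antimono: "v > 0 \<Longrightarrow> r < r' \<Longrightarrow> gauss_kernel v r' < gauss_kernel v r"
  by (simp add: gauss_kernel_def divide_strict_right_mono)

definition likelihood_profile :: "cr_system \<Rightarrow> decision \<Rightarrow> real \<Rightarrow> real" where
  "likelihood_profile S k r =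
     state_posterior S H0 k * gauss_kernel ((std_noise S)\<^sup>2) r +
     state_posterior S H1 k *
       (\<Sum>l=1..num_comp S. weight S l * gauss_kernel ((std_interf S l)\<^sup>2 + (std_noise S)\<^sup>2) r)"

lemma likelihood_eq_profile:
  "likelihood S h k y i = likelihood_profile S k (received_dist2 S h k y i)"
  by (simp add: likelihood_def likelihood_profile_def gauss_kernel_def symbol_def
      received_dist2_def)

text \<open>Every component is nonincreasing in \<open>r\<close>, and since the weights sum to 1 at
  least one has positive weight and makes the inequality strict.\<close>

lemma mixture_strict_antimono:
  fixes w v :: "'l \<Rightarrow> real"
  assumes "\<And>l. l \<in> A \<Longrightarrow> w l \<ge> 0" "\<And>l. l \<in> A \<Longrightarrow> v l > 0" "(\<Sum>l\<in>A. w l) = 1" "r < r'"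
  shows "(\<Sum>l\<in>A. w l * gauss_kernel (v l) r') < (\<Sum>l\<in>A. w l * gauss_kernel (v l) r)"
proof (rule sum_strict_mono_ex1)
  \<comment> \<open>A sum over an infinite set is 0 by convention, which contradicts the total
    weight 1.\<close>
  show "finite A"
    using assms(3) by (metis sum.infinite zero_neq_one)
  show "\<forall>l\<in>A. w l * gauss_kernel (v l) r' \<le> w l * gauss_kernel (v l) r"
    using assms by (auto intro!: mult_left_mono less_imp_le[OF gauss_kernel_strict_antimono])
  obtain l where "l \<in> A" "w l \<noteq> 0"
    using assms(3) by (metis sum.neutral zero_neq_one)
  then have "l \<in> A" "w l > 0"
    using assms(1)[of l] by auto
  then show "\<exists>l\<in>A. w l * gauss_kernel (v l) r' < w l * gauss_kernel (v l) r"
    using assms by (auto intro!: mult_strict_left_mono gauss_kernel_strict_antimono)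
qed

context
  fixes S :: cr_system and k :: decision
  assumes sensing: "valid_sensing S" and channel: "valid_channel S"
    and decision: "decision_prob S k > 0"
begin

lemma likelihood_profile_strict_antimono:
  assumes "r < r'"
  shows "likelihood_profile S k r' < likelihood_profile S k r"
proof -
  have 0: "gauss_kernel ((std_noise S)\<^sup>2) r' < gauss_kernel ((std_noise S)\<^sup>2) r"
    using channel assms by (intro gauss_kernel_strict_antimono) (auto simp: valid_channel_def)
  have 1: "(\<Sum>l=1..num_comp S. weight S l * gauss_kernel ((std_interf S l)\<^sup>2 + (std_noise S)\<^sup>2) r')
      < (\<Sum>l=1..num_comp S. weight S l * gauss_kernel ((std_interf S l)\<^sup>2 + (std_noise S)\<^sup>2) r)"
    using channel assms
    by (intro mixture_strict_antimono) (auto simp: valid_channel_def intro!: add_pos_pos)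
  have sum1: "state_posterior S H0 k + state_posterior S H1 k = 1"
    using decision by (rule state_posterior_sum)
  note nonneg = state_posterior_nonneg[OF sensing decision]
  show ?thesis
  \<comment> \<open>At least one state has positive posterior. If it is not \<open>H1\<close>, then
    \<open>H0\<close> has posterior 1 and the noise kernel alone gives strictness; otherwise the
    interference mixture does.\<close>
  proof (cases "state_posterior S H1 k = 0")
    case True
    then show ?thesis using 0 sum1 by (simp add: likelihood_profile_def)
  next
    case False
    then have "state_posterior S H1 k > 0"
      using nonneg[of H1] by simp
    then show ?thesis
      unfolding likelihood_profile_def using 0 1 nonneg[of H0]
      by (intro add_le_less_mono mult_left_mono mult_strict_left_mono) auto
  qed
qed

text \<open>A nonnegative, strictly decreasing profile is positive everywhere: its value at
  \<open>r\<close> exceeds its value at \<open>r + 1\<close>.\<close>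

lemma likelihood_pos: "likelihood S h k y i > 0"
proof -
  define r where "r = received_dist2 S h k y i"
  have "0 \<le> likelihood_profile S k (r + 1)"
    unfolding likelihood_profile_def using channel state_posterior_nonneg[OF sensing decision]
    by (intro add_nonneg_nonneg mult_nonneg_nonneg sum_nonneg less_imp_le[OF gauss_kernel_pos])
      (auto simp: valid_channel_def intro!: add_pos_pos)
  also have "\<dots> < likelihood_profile S k r"
    by (rule likelihood_profile_strict_antimono) simp
  finally show ?thesis
    by (simp add: likelihood_eq_profile r_def)
qed

lemma likelihood_less_iff:
  "likelihood S h k y i < likelihood S h k y j \<longleftrightarrow>
    received_dist2 S h k y j < received_dist2 S h k y i"
  unfolding likelihood_eq_profile
  using likelihood_profile_strict_antimono
    [of "received_dist2 S h k y i" "received_dist2 S h k y j"]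
    likelihood_profile_strict_antimono[of "received_dist2 S h k y j" "received_dist2 S h k y i"]
  by (cases "received_dist2 S h k y i" "received_dist2 S h k y j" rule: linorder_cases) auto

lemma arg_max_likelihood_iff:
  assumes "d_min S k > 0" "h \<noteq> 0" "i \<in> symbol_indices S"
  shows "is_arg_max (likelihood S h k y) (\<lambda>j. j \<in> symbol_indices S) i \<longleftrightarrow>
    y \<in> midpoint_region S h k i"
  unfolding nearest_point_iff_midpoint[OF assms, symmetric] using assms(3)
  by (auto simp: is_arg_max_def likelihood_less_iff not_less)

text \<open>With equiprobable symbols, Bayes' rule multiplies all likelihoods for a given
  \<open>y\<close> by the same positive factor, so MAP and maximum likelihood agree.\<close>

lemma arg_max_symbol_posterior_iff:
  "is_arg_max (symbol_posterior S h k y) (\<lambda>j. j \<in> symbol_indices S) i \<longleftrightarrow>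
    is_arg_max (likelihood S h k y) (\<lambda>j. j \<in> symbol_indices S) i"
proof (cases "i \<in> symbol_indices S")
  case True
  have fin: "finite (symbol_indices S)"
    by (simp add: symbol_indices_def)
  then have prior: "symbol_prior S j > 0" for j
    using True by (auto simp: symbol_prior_def card_gt_0_iff)
  have uniform: "symbol_prior S j = symbol_prior S i" for j
    by (simp add: symbol_prior_def)
  have "(\<Sum>j\<in>symbol_indices S. symbol_prior S j * likelihood S h k y j) > 0"
    using True fin by (intro sum_pos mult_pos_pos prior likelihood_pos) auto
  then have "symbol_posterior S h k y i < symbol_posterior S h k y j \<longleftrightarrow>
      likelihood S h k y i < likelihood S h k y j" for j
    unfolding symbol_posterior_def uniform[of j] using prior[of i]
    by (simp only: divide_strict_right_mono divide_less_cancel mult_less_cancel_left_pos) auto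
  then show ?thesis
    by (simp add: is_arg_max_def)
\<comment> \<open>Outside the index set both sides are false.\<close>
qed (simp add: is_arg_max_def)

end

section \<open>Integrability\<close>

text \<open>Lebesgue measure on the complex plane is the product over the basis 1 and
  \<open>\<i>\<close>, so the integral factors into two finite ones.\<close>

lemma integrable_complex_product:
  fixes f g :: "real \<Rightarrow> real"
  assumes f: "integrable lborel f" and g: "integrable lborel g"
    and nonneg: "\<And>x. f x \<ge> 0" "\<And>x. g x \<ge> 0"
  shows "integrable lborel (\<lambda>z::complex. f (Re z) * g (Im z))"
proof (rule integrableI_nonneg)
  have [measurable]: "f \<in> borel_measurable borel" "g \<in> borel_measurable borel"
    using f g by (auto dest: borel_measurable_integrable)
  show "(\<lambda>z::complex. f (Re z) * g (Im z)) \<in> borel_measurable lborel"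
    by measurable
  show "AE z in lborel. 0 \<le> f (Re z) * g (Im z)"
    using nonneg by simp
  \<comment> \<open>Attaches \<open>f\<close> to the real axis and \<open>g\<close> to the imaginary
    axis, to match the form of a product over basis vectors.\<close>
  define F where "F = (\<lambda>b::complex. if b = 1 then f else g)"
  have F: "F b \<in> borel_measurable borel" "F b x \<ge> 0" for b x
    using nonneg by (auto simp: F_def)
  have "(\<integral>\<^sup>+ z. ennreal (f (Re z) * g (Im z)) \<partial>lborel) =
      (\<integral>\<^sup>+ z. (\<Prod>b\<in>Basis. ennreal (F b (z \<bullet> b))) \<partial>lborel)"
    by (simp add: F_def Basis_complex_def inner_complex_def complex_eq_iff ennreal_mult nonneg)
  also have "\<dots> = (\<Prod>b\<in>(Basis :: complex set). (\<integral>\<^sup>+ x. ennreal (F b x) \<partial>lborel))"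
    using F by (intro nn_integral_lborel_prod) auto
  also have "\<dots> < \<infinity>"
    using f g nonneg
    by (simp add: F_def Basis_complex_def complex_eq_iff nn_integral_eq_integral ennreal_mult_less_top)
  finally show "(\<integral>\<^sup>+ z. ennreal (f (Re z) * g (Im z)) \<partial>lborel) < \<infinity>" .
qed

text \<open>The kernel factors into two one-dimensional normal densities with standard deviation
  \<open>sqrt v\<close>.\<close>

lemma integrable_gauss_kernel:
  assumes "v > 0"
  shows "integrable lborel (\<lambda>z. gauss_kernel v ((Re z - a)\<^sup>2 + (Im z - b)\<^sup>2))"
proof -
  have "gauss_kernel v ((Re z - a)\<^sup>2 + (Im z - b)\<^sup>2) =
      normal_density a (sqrt v) (Re z) * normal_density b (sqrt v) (Im z)" for z
    using assms
    by (simp add: gauss_kernel_def normal_density_def add_divide_distrib diff_divide_distrib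
        flip: exp_add)
  then show ?thesis
    using assms by (auto intro!: integrable_complex_product integrable_normal_density)
qed

lemma integrable_likelihood:
  assumes "valid_channel S"
  shows "integrable lborel (\<lambda>y. likelihood S h k y i)"
  unfolding likelihood_eq_profile likelihood_profile_def received_dist2_def using assms
  by (intro Bochner_Integration.integrable_add integrable_mult_right
      Bochner_Integration.integrable_sum integrable_gauss_kernel)
    (auto simp: valid_channel_def intro!: add_pos_pos)

section \<open>Minimum error detection\<close>

context
  fixes M :: "'a measure" and I :: "'i set" and L :: "'a \<Rightarrow> 'i \<Rightarrow> real"
  assumes fin: "finite I" and L: "\<And>i. i \<in> I \<Longrightarrow> integrable M (\<lambda>y. L y i)"
begin

lemma integrable_indicator_detector:
  assumes [measurable]: "\<delta> \<in> measurable M (count_space I)" and i: "i \<in> I"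
  shows "integrable M (\<lambda>y. indicator {y. \<delta> y = i} y *\<^sub>R L y i)"
    and "integrable M (\<lambda>y. indicator {y. \<delta> y \<noteq> i} y *\<^sub>R L y i)"
proof -
  have [measurable]: "(\<lambda>y. L y i) \<in> borel_measurable M"
    using L[OF i] by (rule borel_measurable_integrable)
  have m: "Measurable.pred M (\<lambda>y. \<delta> y = i)"
    using measurable_sets[OF assms(1), of "{i}"] i
    by (simp add: pred_def vimage_def Int_def conj_commute)
  have "integrable M (\<lambda>y. if \<delta> y = i then L y i else 0)"
    using m by (intro Bochner_Integration.integrable_bound[OF L[OF i]]) auto
  then show eq: "integrable M (\<lambda>y. indicator {y. \<delta> y = i} y *\<^sub>R L y i)"
    by (rule Bochner_Integration.integrable_cong[THEN iffD1, rotated -1]) (auto simp: indicator_def)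
  have "(\<lambda>y. indicator {y. \<delta> y \<noteq> i} y *\<^sub>R L y i) =
      (\<lambda>y. L y i - indicator {y. \<delta> y = i} y *\<^sub>R L y i)"
    by (auto simp: indicator_def)
  then show "integrable M (\<lambda>y. indicator {y. \<delta> y \<noteq> i} y *\<^sub>R L y i)"
    using L[OF i] eq by simp
qed

text \<open>Exactly one indicator is nonzero, as the detector takes values in \<open>I\<close>. This
  turns the integral of the detected likelihood into a sum over decision regions.\<close>

lemma detected_likelihood_eq_sum:
  assumes "\<delta> \<in> measurable M (count_space I)" "y \<in> space M"
  shows "L y (\<delta> y) = (\<Sum>i\<in>I. indicator {y. \<delta> y = i} y *\<^sub>R L y i)"
proof -
  have "\<delta> y \<in> I"
    using measurable_space[OF assms] by simp
  then show ?thesis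
    using fin by (simp add: indicator_def if_distrib sum.delta cong: if_cong)
qed

lemma integrable_detected_likelihood:
  assumes "\<delta> \<in> measurable M (count_space I)"
  shows "integrable M (\<lambda>y. L y (\<delta> y))"
  using integrable_indicator_detector(1)[OF assms]
  by (subst Bochner_Integration.integrable_cong[OF refl detected_likelihood_eq_sum[OF assms]])
    (auto intro!: Bochner_Integration.integrable_sum)

text \<open>For each symbol the missed mass is the total mass minus the mass on its decision region.
  The totals do not depend on \<open>\<delta>\<close>, so only the integral of the detected
  likelihood varies.\<close>

lemma error_eq_total_minus_detected:
  assumes \<delta>: "\<delta> \<in> measurable M (count_space I)"
  shows "(\<Sum>i\<in>I. c * set_lebesgue_integral M {y. \<delta> y \<noteq> i} (\<lambda>y. L y i)) =
    c * ((\<Sum>i\<in>I. LINT y|M. L y i) - (LINT y|M. L y (\<delta> y)))"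
proof -
  have miss: "set_lebesgue_integral M {y. \<delta> y \<noteq> i} (\<lambda>y. L y i) =
      (LINT y|M. L y i) - (LINT y|M. indicator {y. \<delta> y = i} y *\<^sub>R L y i)" if "i \<in> I" for i
  proof -
    have "(\<lambda>y. indicator {y. \<delta> y \<noteq> i} y *\<^sub>R L y i) =
        (\<lambda>y. L y i - indicator {y. \<delta> y = i} y *\<^sub>R L y i)"
      by (auto simp: indicator_def)
    then show ?thesis
      unfolding set_lebesgue_integral_def
      using Bochner_Integration.integral_diff[OF L[OF that]
          integrable_indicator_detector(1)[OF \<delta> that]] by simp
  qed
  have "(LINT y|M. L y (\<delta> y)) = (\<Sum>i\<in>I. LINT y|M. indicator {y. \<delta> y = i} y *\<^sub>R L y i)"
    by (subst Bochner_Integration.integral_cong[OF refl detected_likelihood_eq_sum[OF \<delta>]])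
      (simp_all only: Bochner_Integration.integral_sum integrable_indicator_detector[OF \<delta>])
  then show ?thesis
    by (simp add: miss sum_subtractf flip: sum_distrib_left)
qed

lemma arg_min_error_iff:
  assumes \<delta>: "\<delta> \<in> measurable M (count_space I)" and c: "c > 0"
  shows "is_arg_min (\<lambda>\<delta>. \<Sum>i\<in>I. c * set_lebesgue_integral M {y. \<delta> y \<noteq> i} (\<lambda>y. L y i))
      (\<lambda>\<delta>'. \<delta>' \<in> measurable M (count_space I)) \<delta> \<longleftrightarrow>
    (AE y in M. is_arg_max (L y) (\<lambda>i. i \<in> I) (\<delta> y))"
proof -
  have "is_arg_min (\<lambda>\<delta>. \<Sum>i\<in>I. c * set_lebesgue_integral M {y. \<delta> y \<noteq> i} (\<lambda>y. L y i))
      (\<lambda>\<delta>'. \<delta>' \<in> measurable M (count_space I)) \<delta> \<longleftrightarrow>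
      (\<forall>\<delta>'\<in>measurable M (count_space I). (LINT y|M. L y (\<delta>' y)) \<le> (LINT y|M. L y (\<delta> y)))"
    using \<delta> c unfolding is_arg_min_def
    by (auto simp: error_eq_total_minus_detected mult_less_cancel_left_pos not_less)
  also have "\<dots> \<longleftrightarrow> (AE y in M. \<forall>i\<in>I. L y i \<le> L y (\<delta> y))"
  proof
    assume opt: "\<forall>\<delta>'\<in>measurable M (count_space I).
      (LINT y|M. L y (\<delta>' y)) \<le> (LINT y|M. L y (\<delta> y))"
    have "AE y in M. L y i \<le> L y (\<delta> y)" if i: "i \<in> I" for i
    proof -
      \<comment> \<open>Competitor that switches to \<open>i\<close> exactly where \<open>i\<close>
        is strictly more likely; it can only gain pointwise, while optimality of
        \<open>\<delta>\<close> forbids a gain in the integral.\<close>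
      define \<delta>' where "\<delta>' = (\<lambda>y. if L y (\<delta> y) < L y i then i else \<delta> y)"
      have \<delta>': "\<delta>' \<in> measurable M (count_space I)"
        unfolding \<delta>'_def using i \<delta>
        by (intro measurable_If borel_measurable_less[unfolded pred_def] borel_measurable_integrable
            L integrable_detected_likelihood) auto
      note int = integrable_detected_likelihood[OF \<delta>'] integrable_detected_likelihood[OF \<delta>]
      have nonneg: "0 \<le> L y (\<delta>' y) - L y (\<delta> y)" for y
        by (simp add: \<delta>'_def)
      have "(LINT y|M. L y (\<delta>' y) - L y (\<delta> y)) \<le> 0"
        using opt \<delta>' int by simp
      moreover have "(LINT y|M. L y (\<delta>' y) - L y (\<delta> y)) \<ge> 0"
        using nonneg by simp
      ultimately have "(LINT y|M. L y (\<delta>' y) - L y (\<delta> y)) = 0"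
        by simp
      \<comment> \<open>A nonnegative integrable function with zero integral vanishes almost
        everywhere, so switching occurs only on a null set.\<close>
      then have "AE y in M. L y (\<delta>' y) - L y (\<delta> y) = 0"
        using int nonneg by (subst (asm) integral_nonneg_eq_0_iff_AE) auto
      then show ?thesis
        by eventually_elim (simp add: \<delta>'_def split: if_splits)
    qed
    \<comment> \<open>Finiteness of \<open>I\<close> allows the exceptional null sets of the
      individual symbols to be united.\<close>
    then show "AE y in M. \<forall>i\<in>I. L y i \<le> L y (\<delta> y)"
      using fin by (simp add: AE_finite_all)
  next
    assume max: "AE y in M. \<forall>i\<in>I. L y i \<le> L y (\<delta> y)"
    show "\<forall>\<delta>'\<in>measurable M (count_space I). (LINT y|M. L y (\<delta>' y)) \<le> (LINT y|M. L y (\<delta> y))"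
    proof
      fix \<delta>' assume \<delta>': "\<delta>' \<in> measurable M (count_space I)"
      have "AE y in M. \<delta>' y \<in> I"
        using measurable_space[OF \<delta>'] by auto
      with max have "AE y in M. L y (\<delta>' y) \<le> L y (\<delta> y)"
        by eventually_elim simp
      then show "(LINT y|M. L y (\<delta>' y)) \<le> (LINT y|M. L y (\<delta> y))"
        by (intro integral_mono_AE integrable_detected_likelihood \<delta> \<delta>')
    qed
  qed
  also have "\<dots> \<longleftrightarrow> (AE y in M. is_arg_max (L y) (\<lambda>i. i \<in> I) (\<delta> y))"
    using measurable_space[OF \<delta>] by (intro AE_cong) (auto simp: is_arg_max_def not_less)
  finally show ?thesis .
qed

end

section \<open>Midpoint thresholds for the QAM constellation under each transmitting
  decision\<close>

theorem proposition1:
  fixes S :: cr_system and scheme :: scheme and h :: complex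
  assumes sensing: "valid_sensing S"
    and channel: "valid_channel S"
    and constellation: "M_I S \<ge> 1" "M_Q S \<ge> 1" "M_I S * M_Q S \<ge> 2"
    and fading: "h \<noteq> 0"
  shows "\<forall>k\<in>transmit_decisions scheme. tx_power S k > 0 \<longrightarrow> decision_prob S k > 0 \<longrightarrow>
    (\<forall>y. \<forall>n<M_I S. \<forall>q<M_Q S.
       is_arg_max (likelihood S h k y) (\<lambda>i. i \<in> symbol_indices S) (n, q) \<longleftrightarrow>
         (n + 2 \<le> M_I S \<longrightarrow> Re y \<le> (level_I S k n + d_min S k / 2) * cmod h) \<and>
         (n \<ge> 1 \<longrightarrow> Re y \<ge> (level_I S k n - d_min S k / 2) * cmod h) \<and>
         (q + 2 \<le> M_Q S \<longrightarrow> Im y \<le> (level_Q S k q + d_min S k / 2) * cmod h) \<and>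
         (q \<ge> 1 \<longrightarrow> Im y \<ge> (level_Q S k q - d_min S k / 2) * cmod h)) \<and>
    (\<forall>y. \<forall>i\<in>symbol_indices S.
       is_arg_max (symbol_posterior S h k y) (\<lambda>i'. i' \<in> symbol_indices S) i \<longleftrightarrow>
         y \<in> midpoint_region S h k i) \<and>
    (\<forall>\<delta>\<in>detectors S.
       is_arg_min (error_prob S h k) (\<lambda>\<delta>'. \<delta>' \<in> detectors S) \<delta> \<longleftrightarrow>
         (AE y in lborel. y \<in> midpoint_region S h k (\<delta> y)))"
proof (intro ballI impI)
  fix k
  assume power: "tx_power S k > 0" and decision: "decision_prob S k > 0"
  let ?I = "symbol_indices S"
  have d: "d_min S k > 0"
    using constellation power by (rule d_min_pos)
  note region = arg_max_likelihood_iff[OF sensing channel decision d fading]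
  have post: "\<forall>y. \<forall>i\<in>?I. is_arg_max (symbol_posterior S h k y) (\<lambda>i'. i' \<in> ?I) i \<longleftrightarrow>
      y \<in> midpoint_region S h k i"
    using region by (simp add: arg_max_symbol_posterior_iff[OF sensing channel decision])
  \<comment> \<open>The common prior \<open>1 / real (card ?I)\<close> will serve as the constant
    \<open>c\<close> in the error formula; it is positive because both side lengths are at least
    1.\<close>
  have fin: "finite ?I" and card: "1 / real (card ?I) > 0"
    using constellation by (auto simp: symbol_indices_def card_cartesian_product)
  have err: "is_arg_min (error_prob S h k) (\<lambda>\<delta>'. \<delta>' \<in> detectors S) \<delta> \<longleftrightarrow>
      (AE y in lborel. y \<in> midpoint_region S h k (\<delta> y))" if "\<delta> \<in> detectors S" for \<delta>
  proof -
    \<comment> \<open>\<open>borel\<close> and \<open>lborel\<close> have the same measurable sets,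
      so detectors can be treated as measurable with respect to the integrating measure.\<close>
    have det: "detectors S = measurable lborel (count_space ?I)"
      by (simp add: detectors_def cong: measurable_cong_sets)
    have \<delta>: "\<delta> \<in> measurable lborel (count_space ?I)"
      using that det by simp
    then have "\<delta> y \<in> ?I" for y
      using measurable_space[OF \<delta>, of y] by simp
    then show ?thesis
      using arg_min_error_iff[where L = "likelihood S h k", OF fin integrable_likelihood[OF channel] \<delta> card]
      unfolding det error_prob_def[abs_def] symbol_prior_def by (simp add: region)
  qed
  have grid: "\<forall>y. \<forall>n<M_I S. \<forall>q<M_Q S.
      is_arg_max (likelihood S h k y) (\<lambda>i. i \<in> ?I) (n, q) \<longleftrightarrow>
      y \<in> midpoint_region S h k (n, q)"
    using region by (simp add: symbol_indices_def)
  show "(\<forall>y. \<forall>n<M_I S. \<forall>q<M_Q S.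
       is_arg_max (likelihood S h k y) (\<lambda>i. i \<in> symbol_indices S) (n, q) \<longleftrightarrow>
         (n + 2 \<le> M_I S \<longrightarrow> Re y \<le> (level_I S k n + d_min S k / 2) * cmod h) \<and>
         (n \<ge> 1 \<longrightarrow> Re y \<ge> (level_I S k n - d_min S k / 2) * cmod h) \<and>
         (q + 2 \<le> M_Q S \<longrightarrow> Im y \<le> (level_Q S k q + d_min S k / 2) * cmod h) \<and>
         (q \<ge> 1 \<longrightarrow> Im y \<ge> (level_Q S k q - d_min S k / 2) * cmod h)) \<and>
    (\<forall>y. \<forall>i\<in>symbol_indices S.
       is_arg_max (symbol_posterior S h k y) (\<lambda>i'. i' \<in> symbol_indices S) i \<longleftrightarrow>
         y \<in> midpoint_region S h k i) \<and>
    (\<forall>\<delta>\<in>detectors S.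
       is_arg_min (error_prob S h k) (\<lambda>\<delta>'. \<delta>' \<in> detectors S) \<delta> \<longleftrightarrow>
         (AE y in lborel. y \<in> midpoint_region S h k (\<delta> y)))"
    using grid post err unfolding midpoint_region_def by simp
qed

end
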